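(* Let $k\in\mathbb{N}\cup\{\infty,\omega\}$ with $k\ge 2$, and let $R(x,y)$ be a $\mathcal{C}^k$ symmetric function for which there exists a scalar $x_0\in\mathbb{R}$ such that (i) $R(x_0,y)=y$ and $R(x,x_0)=x$; (ii) $R_x(x_0,z)=R_y(z,x_0)=f(z;x_0)$; (iii) $R_x(a,b)\,R_x(x_0,a)=R_x(x_0,R(a,b))$ and $R_y(a,b)\,R_y(b,x_0)=R_y(R(a,b),x_0)$. Then $R(x,y)$ is the explicit addition formula for the solution $x(t)$ of the initial value problem $$\dot{x}=f(x;x_0),\qquad x(0)=x_0.$$
   Context: $\mathcal{C}^\omega$ denotes the class of real analytic functions. $R_x$ and $R_y$ denote the partial derivatives of $R(x,y)$ with respect to its first and second variable, and symmetric means $R(x,y)=R(y,x)$. The function $f(\,\cdot\,;x_0)$ is the one defined by the common value in condition (ii). A bivariate function $R(x,y)$ is called an explicit addition formula for a real function $x(t)$ when $x(t+\tau)=R(x(t),x(\tau))$ wherever the involved functions $R(x,y)$ and $x(t)$ are defined.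
   Formalization: If R is defined only on an open set, the addition formula is proved on the connected component of (0,0) in the set of (t,τ) where both sides are defined, and on that whole set if the horizontal slices of R's domain are intervals (e.g. R on all of ℝ²); otherwise it can fail. *)

theory Defs
  imports "HOL-Analysis.Analysis"
begin

datatype smoothness = Finite_Order nat | Infinite_Order | Analytic

fun at_least_order :: "nat \<Rightarrow> smoothness \<Rightarrow> bool" where
  "at_least_order n (Finite_Order k) \<longleftrightarrow> n \<le> k"
| "at_least_order n Infinite_Order \<longleftrightarrow> True"
| "at_least_order n Analytic \<longleftrightarrow> True"

text \<open>The sets \<^term>\<open>S\<close> below are meant to be open.\<close>

primrec Cn_on :: "nat \<Rightarrow> (real \<times> real) set \<Rightarrow> (real \<times> real \<Rightarrow> real) \<Rightarrow> bool" where
  "Cn_on 0 S g \<longleftrightarrow> continuous_on S g"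
| "Cn_on (Suc n) S g \<longleftrightarrow>
     (\<forall>p\<in>S. g differentiable (at p)) \<and>
     (\<forall>v. Cn_on n S (\<lambda>p. frechet_derivative g (at p) v))"

definition power_series_at :: "(real \<times> real \<Rightarrow> real) \<Rightarrow> real \<Rightarrow> real \<Rightarrow> bool" where
  "power_series_at g a b \<longleftrightarrow>
     (\<exists>(c :: nat \<times> nat \<Rightarrow> real) r. r > 0 \<and>
        (\<forall>x y. \<bar>x - a\<bar> < r \<and> \<bar>y - b\<bar> < r \<longrightarrow>
           ((\<lambda>(i, j). c (i, j) * (x - a) ^ i * (y - b) ^ j) has_sum g (x, y)) UNIV))"

text \<open>
  As in many textbooks, real analyticity is a strengthening of being infinitely
  differentiable; the power series in \<^const>\<open>power_series_at\<close> is then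
  necessarily the Taylor series.
\<close>

fun smooth_of_order :: "smoothness \<Rightarrow> (real \<times> real) set \<Rightarrow> (real \<times> real \<Rightarrow> real) \<Rightarrow> bool" where
  "smooth_of_order (Finite_Order k) S g \<longleftrightarrow> Cn_on k S g"
| "smooth_of_order Infinite_Order S g \<longleftrightarrow> (\<forall>n. Cn_on n S g)"
| "smooth_of_order Analytic S g \<longleftrightarrow>
     (\<forall>n. Cn_on n S g) \<and> (\<forall>(a, b)\<in>S. power_series_at g a b)"

definition partial_x :: "(real \<Rightarrow> real \<Rightarrow> real) \<Rightarrow> real \<Rightarrow> real \<Rightarrow> real" where
  "partial_x R a b = deriv (\<lambda>s. R s b) a"

definition partial_y :: "(real \<Rightarrow> real \<Rightarrow> real) \<Rightarrow> real \<Rightarrow> real \<Rightarrow> real" where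
  "partial_y R a b = deriv (\<lambda>s. R a s) b"

text \<open>
  \<^term>\<open>x\<close>, with domain the open interval \<^term>\<open>I\<close>, solves the autonomous initial
  value problem whose right-hand side \<^term>\<open>f\<close> has domain \<^term>\<open>J\<close>.
  The interval need not be maximal.
\<close>

definition solves_ivp :: "(real \<Rightarrow> real) \<Rightarrow> real set \<Rightarrow> real \<Rightarrow> real set \<Rightarrow> (real \<Rightarrow> real) \<Rightarrow> bool" where
  "solves_ivp f J x0 I x \<longleftrightarrow>
     open I \<and> is_interval I \<and> 0 \<in> I \<and> x 0 = x0 \<and>
     (\<forall>t\<in>I. x t \<in> J \<and> (x has_real_derivative f (x t)) (at t))"

text \<open>
  The pairs of times at which both sides of the addition formula are defined,
  for \<^term>\<open>R\<close> with domain \<^term>\<open>D\<close> and \<^term>\<open>x\<close> with domain \<^term>\<open>I\<close>.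
\<close>

definition addition_domain :: "(real \<times> real) set \<Rightarrow> real set \<Rightarrow> (real \<Rightarrow> real) \<Rightarrow> (real \<times> real) set" where
  "addition_domain D I x =
     {(t, \<tau>). t \<in> I \<and> \<tau> \<in> I \<and> t + \<tau> \<in> I \<and> (x t, x \<tau>) \<in> D}"

text \<open>
  With \<^term>\<open>T\<close> equal to \<^term>\<open>addition_domain D I x\<close> this is the notion of explicit
  addition formula, valid wherever the functions involved are defined. That cannot be
  expected if \<^term>\<open>D\<close> is an arbitrary open set: on the union of the sets
  \<open>\<bar>x y\<bar> < 1\<close> and \<open>\<bar>x y\<bar> > 2\<close> let \<open>R x y\<close> be \<open>x + y\<close> and \<open>x + y + 1\<close>,
  respectively. All hypotheses hold with \<open>x0 = 0\<close> and \<open>f = 1\<close>, but \<open>x t = t\<close> satisfies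
  the formula only on the first set. Hence the parameter \<^term>\<open>T\<close>.
\<close>

definition explicit_addition_formula_on ::
    "(real \<times> real) set \<Rightarrow> (real \<Rightarrow> real \<Rightarrow> real) \<Rightarrow> (real \<Rightarrow> real) \<Rightarrow> bool" where
  "explicit_addition_formula_on T R x \<longleftrightarrow> (\<forall>(t, \<tau>)\<in>T. x (t + \<tau>) = R (x t) (x \<tau>))"

end

theory Submission
  imports Defs
begin

text \<open>
  Condition (iii) says that the translate \<open>u t = R (x t) b\<close> of the solution by a fixed \<open>b\<close>
  solves the same autonomous equation: by the chain rule and (ii),
  \<open>u' t = R\<^sub>x (x t) b * f (x t) = R\<^sub>x (x t) b * R\<^sub>x x0 (x t) = R\<^sub>x x0 (u t) = f (u t)\<close>.
  For \<open>b = x \<tau>\<close> the function \<open>t \<mapsto> x (t + \<tau>)\<close> solves it as well, and solutions of a scalar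
  equation with a locally Lipschitz right-hand side are unique. Here \<open>f\<close> is locally
  Lipschitz because it is a first derivative of the \<open>C\<^sup>2\<close> function \<open>R\<close>
  (\<open>Cn_on_2_imp_partial_x_lipschitz\<close>, \<open>autonomous_ode_unique\<close>).

  The chain of equalities makes sense only while \<open>u t\<close> stays where \<open>f\<close> is defined. Where the
  addition formula holds, \<open>u t = x (t + \<tau>)\<close> is such a value, hence so are the values nearby.
  Thus the formula spreads from a point to a neighbourhood, first in \<open>t\<close> and then, by the
  symmetry of \<open>R\<close>, in \<open>\<tau>\<close>. The set on which it holds is therefore open and relatively closed
  in the addition domain, and it contains the origin by (i), so that it contains the connected
  component of the origin.

  If the slices of \<open>D\<close> are intervals, the addition domain is connected. Any of its points
  \<open>(t, \<tau>)\<close> can be moved along a horizontal segment to \<open>(0, \<tau>)\<close>, because a solution of a scalar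
  autonomous equation is monotone (\<open>autonomous_ode_between\<close>), and from there along the
  vertical axis to the origin.
\<close>

section \<open>Uniqueness and monotonicity for scalar autonomous equations\<close>

text \<open>
  The zeros of a continuous function form a relatively closed set; if each has a neighbourhood
  of zeros, they also form an open set. This turns the local arguments below into global ones.
\<close>

lemma connected_zero_propagation:
  fixes F :: "'a::topological_space \<Rightarrow> 'b::t1_space" and c :: 'b
  assumes "connected C" "C \<subseteq> A" "open A" "continuous_on A F"
    and "p \<in> C" "F p = c"
    and local: "\<And>q. q \<in> A \<Longrightarrow> F q = c \<Longrightarrow> \<exists>U. open U \<and> q \<in> U \<and> (\<forall>r\<in>U. F r = c)"
    and "q \<in> C"
  shows "F q = c"
proof (rule ccontr)
  assume "F q \<noteq> c"
  define V where "V = A \<inter> F -` (- {c})"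
  define W where "W = interior (F -` {c})"
  have "open V"
    unfolding V_def using assms(3,4) by (intro continuous_open_preimage) auto
  moreover have "open W" by (simp add: W_def)
  moreover have W: "r \<in> W" if "r \<in> A" "F r = c" for r
    using local[OF that] unfolding W_def interior_def by blast
  have "C \<subseteq> W \<union> V"
    using W \<open>C \<subseteq> A\<close> unfolding V_def by blast
  moreover have "W \<inter> V \<inter> C = {}"
    using interior_subset[of "F -` {c}"] unfolding W_def V_def by auto
  moreover have "p \<in> W \<inter> C" using W assms by blast
  moreover have "q \<in> V \<inter> C" using \<open>F q \<noteq> c\<close> assms unfolding V_def by blast
  ultimately show False
    using connectedD[OF \<open>connected C\<close>, of W V] by blast
qed

text \<open>
  This is the differential form of Gronwall's inequality: \<open>d\<^sup>2\<close> multiplied by \<open>exp (-2 L t)\<close>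
  cannot increase to the right of the zero, and multiplied by \<open>exp (2 L t)\<close> it cannot decrease
  to the left of it.
\<close>

lemma gronwall_zero:
  fixes d :: "real \<Rightarrow> real"
  assumes "is_interval S" "s \<in> S" "t \<in> S" "d s = 0"
    and der: "\<And>r. r \<in> S \<Longrightarrow> (d has_real_derivative d' r) (at r)"
    and bnd: "\<And>r. r \<in> S \<Longrightarrow> \<bar>d' r\<bar> \<le> L * \<bar>d r\<bar>"
  shows "d t = 0"
proof -
  have key: "\<bar>d r * d' r\<bar> \<le> L * (d r)\<^sup>2" if "r \<in> S" for r
    using mult_left_mono[OF bnd[OF that], of "\<bar>d r\<bar>"]
    by (simp add: abs_mult power2_eq_square mult.left_commute)
  have der_h: "((\<lambda>r. (d r)\<^sup>2 * exp (m * r)) has_real_derivative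
      (2 * (d r * d' r) + m * (d r)\<^sup>2) * exp (m * r)) (at r)" if "r \<in> S" for m r
    by (rule derivative_eq_intros der[OF that] refl)+ (simp add: algebra_simps)
  have mem: "r \<in> S" if "min s t \<le> r" "r \<le> max s t" for r
    using mem_is_interval_1_I[OF \<open>is_interval S\<close>, of s t r]
      mem_is_interval_1_I[OF \<open>is_interval S\<close>, of t s r] assms(2,3) that
    by (cases "s \<le> t") auto
  have "(d t)\<^sup>2 \<le> 0"
  proof (cases "s \<le> t")
    case True
    have "(d t)\<^sup>2 * exp (- 2 * L * t) \<le> (d s)\<^sup>2 * exp (- 2 * L * s)"
    proof (rule DERIV_nonpos_imp_nonincreasing[OF True])
      fix r assume "s \<le> r" "r \<le> t"
      then have "r \<in> S" using mem by auto
      moreover have "(2 * (d r * d' r) + - 2 * L * (d r)\<^sup>2) * exp (- 2 * L * r) \<le> 0"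
        using key[OF \<open>r \<in> S\<close>] by (intro mult_nonpos_nonneg) auto
      ultimately show "\<exists>y. ((\<lambda>r. (d r)\<^sup>2 * exp (- 2 * L * r)) has_real_derivative y) (at r) \<and> y \<le> 0"
        using der_h by blast
    qed
    then show ?thesis using \<open>d s = 0\<close> by (simp add: mult_le_0_iff)
  next
    case False
    then have "t \<le> s" by simp
    have "(d t)\<^sup>2 * exp (2 * L * t) \<le> (d s)\<^sup>2 * exp (2 * L * s)"
    proof (rule DERIV_nonneg_imp_nondecreasing[OF \<open>t \<le> s\<close>])
      fix r assume "t \<le> r" "r \<le> s"
      then have "r \<in> S" using mem by auto
      moreover have "0 \<le> (2 * (d r * d' r) + 2 * L * (d r)\<^sup>2) * exp (2 * L * r)"
        using key[OF \<open>r \<in> S\<close>] by (intro mult_nonneg_nonneg) auto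
      ultimately show "\<exists>y. ((\<lambda>r. (d r)\<^sup>2 * exp (2 * L * r)) has_real_derivative y) (at r) \<and> 0 \<le> y"
        using der_h by blast
    qed
    then show ?thesis using \<open>d s = 0\<close> by (simp add: mult_le_0_iff)
  qed
  then show ?thesis by simp
qed

lemma autonomous_ode_unique:
  fixes f u v :: "real \<Rightarrow> real"
  assumes lip: "\<And>z. z \<in> J \<Longrightarrow> \<exists>e>0. \<exists>L. L-lipschitz_on (cball z e) f"
    and "open S" "is_interval S"
    and u: "\<And>r. r \<in> S \<Longrightarrow> u r \<in> J \<and> (u has_real_derivative f (u r)) (at r)"
    and v: "\<And>r. r \<in> S \<Longrightarrow> v r \<in> J \<and> (v has_real_derivative f (v r)) (at r)"
    and "s \<in> S" "u s = v s" "t \<in> S"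
  shows "u t = v t"
proof -
  have cont: "isCont u r" "isCont v r" if "r \<in> S" for r
    using u[OF that] v[OF that] DERIV_isCont by blast+
  have "u t - v t = 0"
  proof (rule connected_zero_propagation[where F = "\<lambda>r. u r - v r" and C = S and A = S and p = s])
    show "connected S" using \<open>is_interval S\<close> by (simp add: is_interval_connected_1)
    show "continuous_on S (\<lambda>r. u r - v r)"
      using cont by (intro continuous_intros continuous_at_imp_continuous_on ballI) auto
  next
    fix q assume "q \<in> S" and eq: "u q - v q = 0"
    obtain e L where "e > 0" and L: "L-lipschitz_on (cball (u q) e) f"
      using lip u[OF \<open>q \<in> S\<close>] by blast
    have "\<forall>\<^sub>F r in nhds q. u r \<in> cball (u q) e \<and> v r \<in> cball (u q) e \<and> r \<in> S"
    proof -
      have "\<forall>\<^sub>F r in nhds q. w r \<in> cball (u q) e" if "isCont w q" "w q = u q" for w :: "real \<Rightarrow> real"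
        using tendstoD[OF that(1)[unfolded isCont_def tendsto_at_iff_tendsto_nhds] \<open>e > 0\<close>] that(2)
        by (auto simp: dist_commute elim!: eventually_mono)
      then show ?thesis
        using cont[OF \<open>q \<in> S\<close>] eq \<open>q \<in> S\<close> \<open>open S\<close>
        by (auto intro!: eventually_conj eventually_nhds_in_open)
    qed
    then obtain \<delta> where "\<delta> > 0" and
      near: "\<And>r. dist r q < \<delta> \<Longrightarrow> u r \<in> cball (u q) e \<and> v r \<in> cball (u q) e \<and> r \<in> S"
      unfolding eventually_nhds_metric by blast
    have "u r - v r = 0" if "r \<in> ball q \<delta>" for r
    proof (rule gronwall_zero[where S = "ball q \<delta>" and s = q and t = r and L = L
          and d = "\<lambda>r. u r - v r" and d' = "\<lambda>r. f (u r) - f (v r)"])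
      show "is_interval (ball q \<delta>)" by (simp add: is_interval_ball_real)
    next
      fix r assume "r \<in> ball q \<delta>"
      then have r: "u r \<in> cball (u q) e" "v r \<in> cball (u q) e" "r \<in> S"
        using near[of r] by (auto simp: dist_commute)
      show "((\<lambda>r. u r - v r) has_real_derivative f (u r) - f (v r)) (at r)"
        using u v r by (intro DERIV_diff) auto
      show "\<bar>f (u r) - f (v r)\<bar> \<le> L * \<bar>u r - v r\<bar>"
        using lipschitz_onD[OF L r(1,2)] by (simp add: dist_real_def)
    qed (use that eq \<open>\<delta> > 0\<close> in auto)
    then show "\<exists>U. open U \<and> q \<in> U \<and> (\<forall>r\<in>U. u r - v r = 0)"
      using \<open>\<delta> > 0\<close> by (intro exI[of _ "ball q \<delta>"]) auto
  qed (use assms in auto)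
  then show ?thesis by simp
qed

text \<open>
  A solution that takes some value twice has a critical point by Rolle's theorem, hence passes
  through a zero of \<open>f\<close> and coincides with the constant solution there. So a solution is
  constant or injective, and in both cases monotone.
\<close>

lemma autonomous_ode_between:
  fixes f u :: "real \<Rightarrow> real"
  assumes lip: "\<And>z. z \<in> J \<Longrightarrow> \<exists>e>0. \<exists>L. L-lipschitz_on (cball z e) f"
    and "open S" "is_interval S"
    and u: "\<And>r. r \<in> S \<Longrightarrow> u r \<in> J \<and> (u has_real_derivative f (u r)) (at r)"
    and "a \<in> S" "b \<in> S" "a \<le> s" "s \<le> b"
  shows "u a \<le> u s \<and> u s \<le> u b \<or> u b \<le> u s \<and> u s \<le> u a"
proof (cases "inj_on u S")
  case True
  have sub: "{a..b} \<subseteq> S"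
    using mem_is_interval_1_I[OF \<open>is_interval S\<close> \<open>a \<in> S\<close> \<open>b \<in> S\<close>] by auto
  have "continuous_on {a..b} u"
    using u sub by (intro continuous_at_imp_continuous_on ballI DERIV_isCont) blast
  moreover have "inj_on u {a..b}" using True sub inj_on_subset by blast
  ultimately show ?thesis
    using continuous_inj_imp_mono[of a s b u] \<open>a \<le> s\<close> \<open>s \<le> b\<close> by fastforce
next
  case False
  then obtain p q where pq: "p \<in> S" "q \<in> S" "p < q" "u p = u q"
    unfolding inj_on_def by (metis linorder_neqE_linordered_idom)
  have sub: "{p..q} \<subseteq> S"
    using mem_is_interval_1_I[OF \<open>is_interval S\<close> pq(1,2)] by auto
  have "continuous_on {p..q} u"
    using u sub by (intro continuous_at_imp_continuous_on ballI DERIV_isCont) blast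
  moreover have "u differentiable (at r)" if "p < r" "r < q" for r
  proof -
    have "r \<in> S" using sub that by auto
    then show ?thesis using u[of r] unfolding real_differentiable_def by blast
  qed
  ultimately obtain z where z: "p < z" "z < q" "DERIV u z :> 0"
    using Rolle[OF pq(3,4)] by blast
  then have "z \<in> S" using sub by auto
  then have "f (u z) = 0" using u z DERIV_unique by blast
  then have "u r = u z" if "r \<in> S" for r
    using autonomous_ode_unique[where u = u and v = "\<lambda>_. u z" and s = z and t = r,
        OF lip \<open>open S\<close> \<open>is_interval S\<close> u] \<open>z \<in> S\<close> u that by auto
  moreover have "s \<in> S"
    using mem_is_interval_1_I[OF \<open>is_interval S\<close>] assms(5-8) by blast
  ultimately show ?thesis using assms by simp
qed

section \<open>Smooth functions of two variables\<close>

lemma Cn_on_Suc_imp: "Cn_on (Suc n) S g \<Longrightarrow> Cn_on n S g"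
proof (induction n arbitrary: g)
  case 0
  then show ?case
    by (auto intro!: continuous_at_imp_continuous_on differentiable_imp_continuous_within)
next
  case (Suc n)
  then show ?case
    using Cn_on.simps(2) by blast
qed

lemma Cn_on_antimono: "m \<le> n \<Longrightarrow> Cn_on n S g \<Longrightarrow> Cn_on m S g"
  by (induction rule: dec_induct) (auto dest: Cn_on_Suc_imp simp del: Cn_on.simps)

lemma smooth_of_order_imp_Cn_on:
  "at_least_order n k \<Longrightarrow> smooth_of_order k S g \<Longrightarrow> Cn_on n S g"
  by (cases k) (auto intro: Cn_on_antimono)

lemma differentiable_imp_partial_x:
  assumes "(\<lambda>(a, b). R a b) differentiable (at (a, b))"
  shows "((\<lambda>s. R s b) has_real_derivative partial_x R a b) (at a)"
    and "partial_x R a b = frechet_derivative (\<lambda>(a, b). R a b) (at (a, b)) (1, 0)"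
proof -
  let ?g = "\<lambda>(a, b). R a b"
  let ?F = "frechet_derivative ?g (at (a, b))"
  have F: "(?g has_derivative ?F) (at (a, b))"
    using assms frechet_derivative_works by blast
  have "((\<lambda>s. (s, b)) has_derivative (\<lambda>h. (h, 0))) (at a)"
    by (auto intro!: derivative_eq_intros)
  from has_derivative_compose[OF this F]
  have "((\<lambda>s. R s b) has_derivative (\<lambda>h. ?F (h, 0))) (at a)" by simp
  moreover have "(\<lambda>h. ?F (h, 0)) = (*) (?F (1, 0))"
  proof
    fix h
    show "?F (h, 0) = ?F (1, 0) * h"
      using linear_scale[OF has_derivative_linear[OF F], of h "(1, 0)"] by simp
  qed
  ultimately have *: "((\<lambda>s. R s b) has_real_derivative ?F (1, 0)) (at a)"
    by (simp add: has_field_derivative_def)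
  then show "partial_x R a b = ?F (1, 0)"
    unfolding partial_x_def by (rule DERIV_imp_deriv)
  with * show "((\<lambda>s. R s b) has_real_derivative partial_x R a b) (at a)" by simp
qed

text \<open>
  The mixed second derivative of \<open>R\<close> is continuous, hence bounded on a compact segment around
  \<open>z\<close>, and its bound is a Lipschitz constant by the mean value theorem.
\<close>

lemma Cn_on_2_imp_partial_x_lipschitz:
  assumes "Cn_on 2 D (\<lambda>(a, b). R a b)" "open D" "(c, z) \<in> D"
  shows "\<exists>e>0. \<exists>L. L-lipschitz_on (cball z e) (partial_x R c) \<and> (\<forall>y\<in>cball z e. (c, y) \<in> D)"
proof -
  let ?g = "\<lambda>(a, b). R a b"
  define G where "G = (\<lambda>p. frechet_derivative ?g (at p) (1, 0))"
  define H where "H = (\<lambda>p. frechet_derivative G (at p) (0, 1))"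
  have C: "Cn_on (Suc (Suc 0)) D ?g"
    using assms(1) by (simp only: numeral_2_eq_2)
  have diff_g: "?g differentiable (at p)" if "p \<in> D" for p
    using C that unfolding Cn_on.simps by blast
  have diff_G: "G differentiable (at p)" if "p \<in> D" for p
    using C that unfolding Cn_on.simps G_def by blast
  have cont_H: "continuous_on D H"
    using C unfolding Cn_on.simps G_def H_def by blast
  have der: "((\<lambda>y. G (c, y)) has_real_derivative H (c, y)) (at y)" if "(c, y) \<in> D" for y
  proof -
    let ?F = "frechet_derivative G (at (c, y))"
    have F: "(G has_derivative ?F) (at (c, y))"
      using diff_G[OF that] frechet_derivative_works by blast
    have "((\<lambda>y. (c, y)) has_derivative (\<lambda>h. (0, h))) (at y)"
      by (auto intro!: derivative_eq_intros)
    from has_derivative_compose[OF this F]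
    have "((\<lambda>y. G (c, y)) has_derivative (\<lambda>h. ?F (0, h))) (at y)" by simp
    moreover have "(\<lambda>h. ?F (0, h)) = (*) (H (c, y))"
    proof
      fix h
      show "?F (0, h) = H (c, y) * h"
        using linear_scale[OF has_derivative_linear[OF F], of h "(0, 1)"] by (simp add: H_def)
    qed
    ultimately show ?thesis by (simp add: has_field_derivative_def)
  qed
  have "open {y. (c, y) \<in> D}"
    using open_vimage[OF \<open>open D\<close>, of "Pair c"]
    by (simp add: vimage_def continuous_on_Pair)
  then obtain e where "e > 0" and e: "cball z e \<subseteq> {y. (c, y) \<in> D}"
    using assms(3) open_contains_cball by blast
  have "compact ((\<lambda>y. H (c, y)) ` cball z e)"
    using e by (intro compact_continuous_image continuous_on_compose2[OF cont_H] continuous_intros) auto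
  then obtain B where B: "\<And>y. y \<in> cball z e \<Longrightarrow> norm (H (c, y)) \<le> B"
    using compact_imp_bounded bounded_iff by (metis (no_types, lifting) image_eqI)
  have "B-lipschitz_on (cball z e) (partial_x R c)"
  proof (rule lipschitz_onI)
    show "0 \<le> B" using B[of z] norm_ge_zero[of "H (c, z)"] \<open>e > 0\<close> by simp
  next
    fix y y' assume y: "y \<in> cball z e" "y' \<in> cball z e"
    have "norm (G (c, y) - G (c, y')) \<le> B * norm (y - y')"
    proof (rule field_differentiable_bound[where S = "cball z e" and f' = "\<lambda>y. H (c, y)"])
      fix w assume "w \<in> cball z e"
      then show "((\<lambda>y. G (c, y)) has_field_derivative H (c, w)) (at w within cball z e)"
        using e by (blast intro: has_field_derivative_at_within der)
    qed (use y B in simp_all)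
    moreover have "partial_x R c w = G (c, w)" if "w \<in> cball z e" for w
      unfolding G_def using e that by (intro differentiable_imp_partial_x(2) diff_g) auto
    ultimately show "dist (partial_x R c y) (partial_x R c y') \<le> B * dist y y'"
      using y by (simp add: dist_norm)
  qed
  then show ?thesis using \<open>e > 0\<close> e by blast
qed

section \<open>The addition formula\<close>

theorem theorem2p7:
  fixes k :: smoothness
    and R :: "real \<Rightarrow> real \<Rightarrow> real" and D :: "(real \<times> real) set"
    and x0 :: real and f :: "real \<Rightarrow> real"
    and x :: "real \<Rightarrow> real" and I :: "real set"
  assumes "at_least_order 2 k"
    and "open D"
    and "smooth_of_order k D (\<lambda>(a, b). R a b)"
    and symmetric: "\<forall>a b. (a, b) \<in> D \<longrightarrow> (b, a) \<in> D \<and> R a b = R b a"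
    and i: "\<forall>y. (x0, y) \<in> D \<longrightarrow> R x0 y = y"
           "\<forall>y. (y, x0) \<in> D \<longrightarrow> R y x0 = y"
    and ii: "\<forall>z. (x0, z) \<in> D \<longrightarrow> partial_x R x0 z = f z \<and> partial_y R z x0 = f z"
    and iii: "\<forall>a b. (a, b) \<in> D \<and> (x0, a) \<in> D \<and> (x0, R a b) \<in> D \<longrightarrow>
                partial_x R a b * partial_x R x0 a = partial_x R x0 (R a b)"
             "\<forall>a b. (a, b) \<in> D \<and> (b, x0) \<in> D \<and> (R a b, x0) \<in> D \<longrightarrow>
                partial_y R a b * partial_y R b x0 = partial_y R (R a b) x0"
    and solution: "solves_ivp f {z. (x0, z) \<in> D} x0 I x"
  shows "explicit_addition_formula_on
           (connected_component_set (addition_domain D I x) (0, 0)) R x \<and>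
         ((\<forall>b. is_interval {a. (a, b) \<in> D}) \<longrightarrow>
           explicit_addition_formula_on (addition_domain D I x) R x)"
proof -
  define J where "J = {z. (x0, z) \<in> D}"
  define A where "A = addition_domain D I x"
  have C2: "Cn_on 2 D (\<lambda>(a, b). R a b)"
    using assms(1,3) by (rule smooth_of_order_imp_Cn_on)
  then have diff: "(\<lambda>(a, b). R a b) differentiable (at p)" if "p \<in> D" for p
    using that by (simp add: numeral_2_eq_2)
  have cont_R: "continuous_on D (\<lambda>(a, b). R a b)"
    using Cn_on_antimono[OF _ C2, of 0] by simp
  have lip: "\<exists>e>0. \<exists>L. L-lipschitz_on (cball z e) f" if z: "z \<in> J" for z
  proof -
    obtain e L where "e > 0" and L: "L-lipschitz_on (cball z e) (partial_x R x0)"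
      and D: "\<forall>y\<in>cball z e. (x0, y) \<in> D"
      using Cn_on_2_imp_partial_x_lipschitz[OF C2 \<open>open D\<close>, of x0 z] z
      unfolding J_def by blast
    have "L-lipschitz_on (cball z e) f"
      using lipschitz_on_transform[OF L, of f] ii D by simp
    then show ?thesis using \<open>e > 0\<close> by blast
  qed
  have "open J"
    unfolding J_def using open_vimage[OF \<open>open D\<close>, of "Pair x0"]
    by (simp add: vimage_def continuous_on_Pair)
  have I: "open I" "is_interval I" "0 \<in> I" and x_0: "x 0 = x0"
    and x: "\<And>t. t \<in> I \<Longrightarrow> x t \<in> J \<and> (x has_real_derivative f (x t)) (at t)"
    using solution unfolding solves_ivp_def J_def by auto
  have cont_x: "continuous_on I x"
    using x by (intro continuous_at_imp_continuous_on ballI DERIV_isCont) blast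
  have A_iff: "(t, \<tau>) \<in> A \<longleftrightarrow> t \<in> I \<and> \<tau> \<in> I \<and> t + \<tau> \<in> I \<and> (x t, x \<tau>) \<in> D" for t \<tau>
    by (simp add: A_def addition_domain_def)
  define T where "T = {(t, \<tau>). t \<in> I \<and> \<tau> \<in> I \<and> t + \<tau> \<in> I}"
  have T_eq: "T = I \<times> I \<inter> (\<lambda>p. fst p + snd p) -` I"
    by (auto simp: T_def)
  have "open T"
    unfolding T_eq using I
    by (intro open_Int open_Times open_vimage continuous_intros)
  have cont_xx: "continuous_on T (\<lambda>p. (x (fst p), x (snd p)))"
    by (intro continuous_intros continuous_on_compose2[OF cont_x]) (auto simp: T_def)
  have A_eq: "A = T \<inter> (\<lambda>p. (x (fst p), x (snd p))) -` D"
    by (auto simp: A_def addition_domain_def T_def)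
  have "open A"
    unfolding A_eq by (intro continuous_open_preimage cont_xx \<open>open T\<close> \<open>open D\<close>)
  have cont_RA: "continuous_on A (\<lambda>p. R (x (fst p)) (x (snd p)))"
    using continuous_on_compose2[OF cont_R continuous_on_subset[OF cont_xx], of A]
    by (auto simp: A_eq)
  \<comment> \<open>On \<open>B\<close> the translated solution stays in the domain of \<open>f\<close>.\<close>
  define B where "B = A \<inter> (\<lambda>p. R (x (fst p)) (x (snd p))) -` J"
  have "open B"
    unfolding B_def by (intro continuous_open_preimage cont_RA \<open>open A\<close> \<open>open J\<close>)
  have B_swap: "(\<tau>, t) \<in> B" if "(t, \<tau>) \<in> B" for t \<tau>
    using that symmetric by (auto simp: B_def A_iff add.commute)

  have along_line: "x (t + \<tau>) = R (x t) (x \<tau>)"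
    if S: "open S" "is_interval S" "S \<times> {\<tau>} \<subseteq> B" "s \<in> S" "t \<in> S"
      and s: "x (s + \<tau>) = R (x s) (x \<tau>)" for S s t \<tau>
  proof (rule autonomous_ode_unique[where u = "\<lambda>t. x (t + \<tau>)" and v = "\<lambda>t. R (x t) (x \<tau>)",
        OF lip S(1,2) _ _ S(4) s S(5)])
    fix r assume "r \<in> S"
    then have r: "r \<in> I" "r + \<tau> \<in> I" "(x r, x \<tau>) \<in> D" "R (x r) (x \<tau>) \<in> J"
      using S(3) by (auto simp: B_def A_iff)
    show "x (r + \<tau>) \<in> J \<and> ((\<lambda>t. x (t + \<tau>)) has_real_derivative f (x (r + \<tau>))) (at r)"
      using x[OF r(2)] by (simp add: DERIV_shift)
    have "((\<lambda>t. R (x t) (x \<tau>)) has_real_derivative partial_x R (x r) (x \<tau>) * f (x r)) (at r)"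
      using DERIV_chain2[where f = "\<lambda>a. R a (x \<tau>)" and g = x,
          OF differentiable_imp_partial_x(1)[OF diff[OF r(3)]]] x[OF r(1)] by blast
    moreover have "partial_x R (x r) (x \<tau>) * f (x r) = f (R (x r) (x \<tau>))"
      using iii(1) ii x[OF r(1)] r unfolding J_def by (metis mem_Collect_eq)
    ultimately show "R (x r) (x \<tau>) \<in> J \<and>
        ((\<lambda>t. R (x t) (x \<tau>)) has_real_derivative f (R (x r) (x \<tau>))) (at r)"
      using r by simp
  qed

  define E where "E = (\<lambda>p. x (fst p + snd p) - R (x (fst p)) (x (snd p)))"
  have cont_E: "continuous_on A E"
    unfolding E_def
    by (intro continuous_on_diff cont_RA continuous_on_compose2[OF cont_x] continuous_intros)
      (auto simp: A_iff)
  have local: "\<exists>U. open U \<and> q \<in> U \<and> (\<forall>r\<in>U. E r = 0)" if q: "q \<in> A" "E q = 0" for q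
  proof -
    obtain t0 \<tau>0 where q_eq: "q = (t0, \<tau>0)" by force
    have eq0: "x (t0 + \<tau>0) = R (x t0) (x \<tau>0)" using q by (simp add: E_def q_eq)
    have "R (x t0) (x \<tau>0) \<in> J"
      using x[of "t0 + \<tau>0"] q eq0 by (auto simp: q_eq A_iff)
    then have "(t0, \<tau>0) \<in> B" using q by (simp add: B_def q_eq)
    then obtain V W where VW: "open V" "open W" "t0 \<in> V" "\<tau>0 \<in> W" "V \<times> W \<subseteq> B"
      using \<open>open B\<close> by (auto elim: open_prod_elim)
    obtain d e where d: "d > 0" "ball t0 d \<subseteq> V" and e: "e > 0" "ball \<tau>0 e \<subseteq> W"
      using VW by (meson open_contains_ball)
    have box: "ball t0 d \<times> ball \<tau>0 e \<subseteq> B" using VW d e by blast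
    have "E (t, \<tau>) = 0" if t: "t \<in> ball t0 d" and \<tau>: "\<tau> \<in> ball \<tau>0 e" for t \<tau>
    proof -
      have mem: "t0 \<in> ball t0 d" "\<tau>0 \<in> ball \<tau>0 e" using d e by auto
      have "x (t + \<tau>0) = R (x t) (x \<tau>0)"
        using along_line[of "ball t0 d" \<tau>0 t0 t] box mem t eq0
        by (force simp: is_interval_ball_real)
      moreover have sym: "R (x t) (x \<sigma>) = R (x \<sigma>) (x t)" if "\<sigma> \<in> ball \<tau>0 e" for \<sigma>
      proof -
        have "(t, \<sigma>) \<in> B" using box t that by blast
        then show ?thesis using symmetric by (simp add: B_def A_iff)
      qed
      \<comment> \<open>With its arguments exchanged, the formula can be moved along the second variable.\<close>
      ultimately have "x (\<tau>0 + t) = R (x \<tau>0) (x t)"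
        using mem by (simp add: add.commute)
      moreover have "ball \<tau>0 e \<times> {t} \<subseteq> B" using B_swap box t by blast
      ultimately have "x (\<tau> + t) = R (x \<tau>) (x t)"
        using along_line[of "ball \<tau>0 e" t \<tau>0 \<tau>] mem \<tau> by (simp add: is_interval_ball_real)
      then show ?thesis using sym[OF \<tau>] by (simp add: E_def add.commute)
    qed
    then show ?thesis
      using d e by (intro exI[of _ "ball t0 d \<times> ball \<tau>0 e"]) (auto simp: q_eq open_Times)
  qed
  have axis: "(0, \<tau>) \<in> A" if "\<tau> \<in> I" for \<tau>
    using x[OF that] I that by (simp add: A_iff x_0 J_def)
  have "E (0, 0) = 0"
    using i(1) axis[of 0] I by (simp add: E_def A_iff x_0)
  have on_component: "x (t + \<tau>) = R (x t) (x \<tau>)"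
    if "(t, \<tau>) \<in> connected_component_set A (0, 0)" for t \<tau>
  proof -
    have "E (t, \<tau>) = 0"
    proof (rule connected_zero_propagation[OF _ _ \<open>open A\<close> cont_E _ \<open>E (0, 0) = 0\<close> local that])
      show "(0, 0) \<in> connected_component_set A (0, 0)"
        using axis I by (simp add: connected_component_refl)
    qed (simp_all add: connected_component_subset)
    then show ?thesis by (simp add: E_def)
  qed

  have "(t, \<tau>) \<in> connected_component_set A (0, 0)"
    if slices: "\<forall>b. is_interval {a. (a, b) \<in> D}" and A: "(t, \<tau>) \<in> A" for t \<tau>
  proof -
    have t: "t \<in> I" "\<tau> \<in> I" "t + \<tau> \<in> I" "(x t, x \<tau>) \<in> D" using A by (auto simp: A_iff)
    have "(s, \<tau>) \<in> A" if s: "s \<in> closed_segment 0 t" for s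
    proof -
      have st: "0 \<le> s \<and> s \<le> t \<or> t \<le> s \<and> s \<le> 0"
        using s by (auto simp: closed_segment_eq_real_ivl split: if_splits)
      then have "s \<in> I" using mem_is_interval_1_I[OF I(2)] I t by blast
      moreover have "\<tau> \<le> s + \<tau> \<and> s + \<tau> \<le> t + \<tau> \<or> t + \<tau> \<le> s + \<tau> \<and> s + \<tau> \<le> \<tau>" using st by auto
      then have "s + \<tau> \<in> I" using mem_is_interval_1_I[OF I(2)] t by blast
      moreover have "x0 \<le> x s \<and> x s \<le> x t \<or> x t \<le> x s \<and> x s \<le> x0"
        using autonomous_ode_between[OF lip I(1,2) x, of 0 t s]
          autonomous_ode_between[OF lip I(1,2) x, of t 0 s] st I t x_0 by auto
      moreover have "(x0, x \<tau>) \<in> D" using axis[OF t(2)] by (simp add: A_iff x_0)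
      then have "(x s, x \<tau>) \<in> D"
        using mem_is_interval_1_I[OF slices[rule_format, of "x \<tau>"]] t calculation(3) by blast
      ultimately show ?thesis using t by (simp add: A_iff)
    qed
    then have "closed_segment 0 t \<times> {\<tau>} \<subseteq> A" by auto
    moreover have "connected (closed_segment 0 t \<times> {\<tau>})" by (intro connected_Times) auto
    ultimately have "connected_component A (0, \<tau>) (t, \<tau>)"
      unfolding connected_component_def by (intro exI[of _ "closed_segment 0 t \<times> {\<tau>}"]) auto
    moreover have "{0} \<times> I \<subseteq> A" using axis by auto
    moreover have "connected ({0::real} \<times> I)"
      using I by (intro connected_Times) (auto simp: is_interval_connected_1)
    then have "connected_component A (0, 0) (0, \<tau>)"
      unfolding connected_component_def using calculation(2) I t
      by (intro exI[of _ "{0} \<times> I"]) auto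
    ultimately show ?thesis
      using connected_component_trans by (metis mem_Collect_eq)
  qed
  with on_component show ?thesis
    unfolding explicit_addition_formula_on_def A_def by blast
qed

end
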